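(* Let $n$ and $k$ be positive integers and $1\le r\le \lfloor n/2\rfloor$. Let $\sigma\in\mathfrak{S}_n$ be an involution with cycle decomposition $\sigma=(a_1\,b_1)(a_2\,b_2)\cdots(a_r\,b_r)$ (all other points fixed), where $a_1,\dots,a_r,b_1,\dots,b_r$ are pairwise distinct. Then the number of fixed points of $\sigma^{\odot k}$ is $$\operatorname{Fix}(\sigma^{\odot k})=\sum_{\ell=0}^{\lfloor k/2\rfloor}\binom{\ell+r-1}{\ell}\binom{k-2\ell+n-2r-1}{k-2\ell}.$$
   Context: For positive integers $n,k$, let $\mathcal{C}_{n,k}$ be the set of weakly increasing $k$-tuples $(i_1\le\cdots\le i_k)$ with entries in $[n]=\{1,\dots,n\}$ (equivalently, $k$-element multisets from $[n]$). For $\sigma\in\mathfrak{S}_n$, the $k$-th symmetric tensor power $\sigma^{\odot k}$ is the permutation of $\mathcal{C}_{n,k}$ sending $(i_1,\dots,i_k)$ to the weakly increasing rearrangement of $(\sigma(i_1),\dots,\sigma(i_k))$ (equivalently, the permutation given by the $k$-th symmetric tensor power of the permutation matrix of $\sigma$). $\operatorname{Fix}(\tau)$ is the number of fixed points of a permutation $\tau$. Binomial coefficients $\binom{a}{b}$ with integer $a$ and nonnegative integer $b$ are $a(a-1)\cdots(a-b+1)/b!$ (so e.g. $\binom{-1}{0}=1$ and $\binom{m-1}{m}=0$ for $m\ge1$). *)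

theory Defs
  imports Complex_Main "HOL-Combinatorics.Permutations"
begin

definition weak_tuples :: "nat \<Rightarrow> nat \<Rightarrow> nat list set" where
  "weak_tuples n k = {xs. length xs = k \<and> set xs \<subseteq> {1..n} \<and> sorted xs}"

text \<open>Extended by the identity outside the set of weakly increasing \<open>k\<close>-tuples, following the
  convention of \<^const>\<open>permutes\<close>.\<close>

definition sym_tensor_power :: "nat \<Rightarrow> nat \<Rightarrow> (nat \<Rightarrow> nat) \<Rightarrow> nat list \<Rightarrow> nat list" where
  "sym_tensor_power n k \<sigma> xs = (if xs \<in> weak_tuples n k then sort (map \<sigma> xs) else xs)"

definition num_fixed_points :: "'a set \<Rightarrow> ('a \<Rightarrow> 'a) \<Rightarrow> nat" where
  "num_fixed_points S \<tau> = card {x \<in> S. \<tau> x = x}"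

definition transposition_product :: "'a list \<Rightarrow> 'a list \<Rightarrow> 'a \<Rightarrow> 'a" where
  "transposition_product a b = foldr (\<circ>) (map2 transpose a b) id"

lemma sym_tensor_power_permutes:
  assumes "\<sigma> permutes {1..n}"
  shows "sym_tensor_power n k \<sigma> permutes weak_tuples n k"
proof (rule bij_imp_permutes)
  have maps: "sort (map p xs) \<in> weak_tuples n k"
    if "p permutes {1..n}" "xs \<in> weak_tuples n k" for p xs
    using that permutes_in_image[OF that(1)] by (fastforce simp: weak_tuples_def)
  have inv_sort: "sort (map q (sort (map p xs))) = xs"
    if "q \<circ> p = id" "xs \<in> weak_tuples n k" for p q and xs :: "nat list"
  proof -
    have "mset (map q (sort (map p xs))) = mset xs"
      using that(1) by (simp add: multiset.map_comp)
    then show ?thesis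
      using that(2) by (intro properties_for_sort) (auto simp: weak_tuples_def)
  qed
  show "bij_betw (sym_tensor_power n k \<sigma>) (weak_tuples n k) (weak_tuples n k)"
    by (rule bij_betw_byWitness[where f' = "\<lambda>xs. sort (map (inv \<sigma>) xs)"])
      (use maps[OF assms] maps[OF permutes_inv[OF assms]] inv_sort permutes_inv_o[OF assms]
        in \<open>auto simp: sym_tensor_power_def\<close>)
qed (simp add: sym_tensor_power_def)

end

theory Submission
  imports Defs
begin

text \<open>
  A \<open>k\<close>-tuple is fixed by the symmetric power of \<open>\<sigma>\<close> iff its multiset of entries is
  \<open>\<sigma>\<close>-invariant. With \<open>A\<close> a set of representatives of the \<open>2\<close>-cycles of \<open>\<sigma>\<close> and \<open>F\<close> its set of fixed
  points, the invariant multisets are exactly \<open>N + \<sigma>(N) + P\<close> for unique multisets \<open>N\<close> on \<open>A\<close>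
  and \<open>P\<close> on \<open>F\<close>. Summing over \<open>\<ell> = |N|\<close> and counting multisets gives the formula.
\<close>

text \<open>In the library's count, \<open>card A + k - 1\<close> truncates when \<open>A\<close> is empty and \<open>k = 0\<close>; both
  binomial coefficients are then \<open>1\<close>.\<close>

lemma card_multisets_of_size_gbinomial:
  assumes "finite A"
  shows "real (card (multisets_of_size A k)) = (real k + real (card A) - 1) gchoose k"
proof (cases "card A + k = 0")
  case True
  then show ?thesis
    by simp
next
  case False
  then have "real k + real (card A) - 1 = real (card A + k - 1)"
    by linarith
  then show ?thesis
    using assms by (simp only: card_multisets_of_size binomial_gbinomial)
qed

text \<open>A weakly increasing tuple is determined by its multiset of entries, and sorting leaves
  that multiset unchanged. So \<open>mset\<close>, with inverse
  \<open>sorted_list_of_multiset\<close>, carries fixed tuples to invariant multisets.\<close>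

lemma num_fixed_points_sym_tensor_power:
  assumes "\<sigma> permutes {1..n}"
  shows "num_fixed_points (weak_tuples n k) (sym_tensor_power n k \<sigma>) =
    card {M \<in> multisets_of_size {1..n} k. image_mset \<sigma> M = M}"
  unfolding num_fixed_points_def
proof (rule bij_betw_same_card)
  have fixed_iff: "sort (map \<sigma> xs) = xs \<longleftrightarrow> image_mset \<sigma> (mset xs) = mset xs"
    if "sorted xs" for xs
    using that by (metis mset_map mset_sort properties_for_sort)
  show "bij_betw mset {xs \<in> weak_tuples n k. sym_tensor_power n k \<sigma> xs = xs}
      {M \<in> multisets_of_size {1..n} k. image_mset \<sigma> M = M}"
  proof (rule bij_betw_byWitness[where f' = sorted_list_of_multiset])
    show "mset ` {xs \<in> weak_tuples n k. sym_tensor_power n k \<sigma> xs = xs} \<subseteq>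
        {M \<in> multisets_of_size {1..n} k. image_mset \<sigma> M = M}"
      using fixed_iff by (auto simp: weak_tuples_def sym_tensor_power_def multisets_of_size_def)
    show "sorted_list_of_multiset ` {M \<in> multisets_of_size {1..n} k. image_mset \<sigma> M = M} \<subseteq>
        {xs \<in> weak_tuples n k. sym_tensor_power n k \<sigma> xs = xs}"
    proof (intro image_subsetI)
      fix M assume "M \<in> {M \<in> multisets_of_size {1..n} k. image_mset \<sigma> M = M}"
      then have M: "set_mset M \<subseteq> {1..n}" "size M = k" "image_mset \<sigma> M = M"
        by (auto simp: multisets_of_size_def)
      have "sorted_list_of_multiset M \<in> weak_tuples n k"
        using M(1,2) size_mset[of "sorted_list_of_multiset M"] by (simp add: weak_tuples_def)
      then show "sorted_list_of_multiset M \<in>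
          {xs \<in> weak_tuples n k. sym_tensor_power n k \<sigma> xs = xs}"
        using M(3) fixed_iff[of "sorted_list_of_multiset M"] by (simp add: sym_tensor_power_def)
    qed
  qed (auto simp: weak_tuples_def sorted_sort_id)
qed

lemma transposition_product_outside:
  assumes "length a = length b" "z \<notin> set a \<union> set b"
  shows "transposition_product a b z = z"
  using assms
  by (induction a b rule: list_induct2) (auto simp: transposition_product_def)

lemma map_transposition_product:
  assumes "length a = length b" "distinct (a @ b)"
  shows "map (transposition_product a b) a = b"
  using assms
proof (induction a b rule: list_induct2)
  case (Cons x xs y ys)
  have unfold: "transposition_product (x # xs) (y # ys) =
      transpose x y \<circ> transposition_product xs ys"
    by (simp add: transposition_product_def)
  have "map (transpose x y) ys = ys"
    using Cons.prems by (intro map_idI) (auto simp: transpose_def)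
  moreover have "map (transposition_product xs ys) xs = ys"
    using Cons by simp
  ultimately have "map (transpose x y \<circ> transposition_product xs ys) xs = ys"
    by (metis map_map)
  then show ?case
    using Cons.prems Cons.hyps transposition_product_outside[of xs ys x]
    by (simp add: unfold comp_def)
qed simp

text \<open>Invariance forces equal multiplicities at \<open>x\<close> and \<sigma>
  \<open>x\<close>, so an invariant multiset is determined by its restrictions to \<open>A\<close>
  and \<open>F\<close>, and these can be prescribed freely.\<close>

lemma card_invariant_multisets:
  fixes \<sigma> :: "'a \<Rightarrow> 'a"
  assumes inv: "\<sigma> \<circ> \<sigma> = id" and fin: "finite A" "finite F"
    and disj: "A \<inter> \<sigma> ` A = {}" "A \<inter> F = {}"
    and fixed: "\<And>x. x \<in> F \<Longrightarrow> \<sigma> x = x"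
  shows "card {M \<in> multisets_of_size (A \<union> \<sigma> ` A \<union> F) k. image_mset \<sigma> M = M} =
    (\<Sum>l = 0..k div 2. card (multisets_of_size A l) * card (multisets_of_size F (k - 2 * l)))"
proof -
  \<comment> \<open>The index \<open>l\<close> records \<open>size N\<close>, so that
    \<open>card S\<close> unfolds to the required sum. The bound on \<open>l\<close> keeps
    \<open>k - 2 * l\<close> from truncating, hence the sizes of the three summands add up to
    \<open>k\<close>.\<close>
  define S where
    "S = (SIGMA l:{0..k div 2}. multisets_of_size A l \<times> multisets_of_size F (k - 2 * l))"
  have \<sigma>\<sigma> [simp]: "\<sigma> (\<sigma> x) = x" for x
    using inv by (metis comp_apply id_apply)
  have \<sigma>_eq_iff: "\<sigma> x = y \<longleftrightarrow> x = \<sigma> y" for x y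
    using \<sigma>\<sigma> by metis
  have disj': "\<sigma> ` A \<inter> F = {}"
  proof -
    \<comment> \<open>If \<sigma> \<open>y\<close> were in \<open>F\<close>, it would be fixed, so
      \<open>y\<close> = \<sigma> (\<sigma> \<open>y\<close>) = \<sigma> \<open>y\<close> would lie
      in both \<open>A\<close> and \<open>F\<close>.\<close>
    have "\<sigma> y \<notin> F" if "y \<in> A" for y
      using that fixed[of "\<sigma> y"] disj(2) by auto
    then show ?thesis
      by auto
  qed
  have image_twice [simp]: "image_mset \<sigma> (image_mset \<sigma> M) = M" for M
    by (simp add: multiset.map_comp inv)
  have image_fixed: "image_mset \<sigma> P = P" if "set_mset P \<subseteq> F" for P
    using that fixed by (metis image_mset_cong multiset.map_ident subsetD)
  have filter_parts:
    "filter_mset (\<lambda>x. x \<in> A) (N + image_mset \<sigma> N + P) = N"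
    "filter_mset (\<lambda>x. x \<in> F) (N + image_mset \<sigma> N + P) = P"
    if "set_mset N \<subseteq> A" "set_mset P \<subseteq> F" for N P
  proof -
    have [simp]: "filter_mset (\<lambda>x. x \<in> A) N = N" "filter_mset (\<lambda>x. x \<in> F) P = P"
      using that by (auto simp: filter_mset_eq_conv)
    have [simp]: "filter_mset (\<lambda>x. x \<in> F) N = {#}" "filter_mset (\<lambda>x. x \<in> A) P = {#}"
      "filter_mset (\<lambda>x. x \<in> A) (image_mset \<sigma> N) = {#}"
      "filter_mset (\<lambda>x. x \<in> F) (image_mset \<sigma> N) = {#}"
      using that disj disj' by (auto simp: disjoint_iff)
    show "filter_mset (\<lambda>x. x \<in> A) (N + image_mset \<sigma> N + P) = N"
      "filter_mset (\<lambda>x. x \<in> F) (N + image_mset \<sigma> N + P) = P"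
      by simp_all
  qed
  have decompose:
    "M = filter_mset (\<lambda>x. x \<in> A) M + image_mset \<sigma> (filter_mset (\<lambda>x. x \<in> A) M)
       + filter_mset (\<lambda>x. x \<in> F) M"
    if M: "set_mset M \<subseteq> A \<union> \<sigma> ` A \<union> F" "image_mset \<sigma> M = M" for M
  proof (rule multiset_eqI)
    fix x
    \<comment> \<open>As \<sigma> is its own inverse, the only preimage of \<open>x\<close> is
      \<sigma> \<open>x\<close>.\<close>
    have count_image: "count (image_mset \<sigma> N) x = count N (\<sigma> x)" for N
      by (induction N) (auto simp: \<sigma>_eq_iff)
    have "count M (\<sigma> x) = count M x"
      using count_image[of M] M(2) by simp
    moreover have "\<sigma> x \<in> A \<longleftrightarrow> x \<in> \<sigma> ` A"
      by (metis \<sigma>\<sigma> image_iff)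
    ultimately show "count M x = count (filter_mset (\<lambda>x. x \<in> A) M
        + image_mset \<sigma> (filter_mset (\<lambda>x. x \<in> A) M) + filter_mset (\<lambda>x. x \<in> F) M) x"
      using M(1) disj disj' not_in_iff[of x M] by (auto simp: count_image)
  qed
  have "bij_betw (\<lambda>(l, N, P). N + image_mset \<sigma> N + P) S
      {M \<in> multisets_of_size (A \<union> \<sigma> ` A \<union> F) k. image_mset \<sigma> M = M}"
  proof (rule bij_betw_byWitness[where f' = "\<lambda>M. (size (filter_mset (\<lambda>x. x \<in> A) M),
        filter_mset (\<lambda>x. x \<in> A) M, filter_mset (\<lambda>x. x \<in> F) M)"])
    show "(\<lambda>(l, N, P). N + image_mset \<sigma> N + P) ` S \<subseteq>
        {M \<in> multisets_of_size (A \<union> \<sigma> ` A \<union> F) k. image_mset \<sigma> M = M}"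
    proof (intro image_subsetI, clarify)
      fix l N P assume "(l, N, P) \<in> S"
      then have NP: "set_mset N \<subseteq> A" "set_mset P \<subseteq> F" "l \<le> k div 2" "size N = l" "size P = k - 2 * l"
        by (auto simp: S_def multisets_of_size_def)
      then have "set_mset (N + image_mset \<sigma> N + P) \<subseteq> A \<union> \<sigma> ` A \<union> F"
        by auto
      moreover have "image_mset \<sigma> (N + image_mset \<sigma> N + P) = N + image_mset \<sigma> N + P"
        using NP(2) by (simp add: image_fixed add_ac)
      ultimately show "N + image_mset \<sigma> N + P \<in> multisets_of_size (A \<union> \<sigma> ` A \<union> F) k \<and>
          image_mset \<sigma> (N + image_mset \<sigma> N + P) = N + image_mset \<sigma> N + P"
        using NP(3-5) by (simp add: multisets_of_size_def)
    qed
    show "(\<lambda>M. (size (filter_mset (\<lambda>x. x \<in> A) M), filter_mset (\<lambda>x. x \<in> A) M,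
          filter_mset (\<lambda>x. x \<in> F) M)) `
        {M \<in> multisets_of_size (A \<union> \<sigma> ` A \<union> F) k. image_mset \<sigma> M = M} \<subseteq> S"
    proof (intro image_subsetI)
      fix M assume "M \<in> {M \<in> multisets_of_size (A \<union> \<sigma> ` A \<union> F) k. image_mset \<sigma> M = M}"
      then have M: "set_mset M \<subseteq> A \<union> \<sigma> ` A \<union> F" "image_mset \<sigma> M = M" "size M = k"
        by (auto simp: multisets_of_size_def)
      have "k = 2 * size (filter_mset (\<lambda>x. x \<in> A) M) + size (filter_mset (\<lambda>x. x \<in> F) M)"
        using arg_cong[OF decompose[OF M(1,2)], of size] M(3) by simp
      then show "(size (filter_mset (\<lambda>x. x \<in> A) M), filter_mset (\<lambda>x. x \<in> A) M,
          filter_mset (\<lambda>x. x \<in> F) M) \<in> S"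
        by (auto simp: S_def multisets_of_size_def)
    qed
    show "\<forall>M \<in> {M \<in> multisets_of_size (A \<union> \<sigma> ` A \<union> F) k. image_mset \<sigma> M = M}.
        (\<lambda>(l, N, P). N + image_mset \<sigma> N + P) (size (filter_mset (\<lambda>x. x \<in> A) M),
          filter_mset (\<lambda>x. x \<in> A) M, filter_mset (\<lambda>x. x \<in> F) M) = M"
      using decompose[symmetric] by (simp add: multisets_of_size_def)
    show "\<forall>t \<in> S. (\<lambda>M. (size (filter_mset (\<lambda>x. x \<in> A) M), filter_mset (\<lambda>x. x \<in> A) M,
        filter_mset (\<lambda>x. x \<in> F) M)) ((\<lambda>(l, N, P). N + image_mset \<sigma> N + P) t) = t"
      \<comment> \<open>Deleting \<open>filter_union_mset\<close> keeps the filters from being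
        distributed over the sum, so that \<open>filter_parts\<close> still matches.\<close>
      using filter_parts
      by (auto simp: S_def multisets_of_size_def simp del: filter_union_mset)
  qed
  then have "card {M \<in> multisets_of_size (A \<union> \<sigma> ` A \<union> F) k. image_mset \<sigma> M = M} = card S"
    by (rule bij_betw_same_card[THEN sym])
  also have "\<dots> = (\<Sum>l = 0..k div 2. card (multisets_of_size A l) * card (multisets_of_size F (k - 2 * l)))"
    unfolding S_def using fin
    by (simp add: finite_multisets_of_size card_cartesian_product)
  finally show ?thesis .
qed

theorem theorem3p1:
  fixes n k r :: nat and \<sigma> :: "nat \<Rightarrow> nat" and a b :: "nat list"
  assumes "n \<ge> 1" and "k \<ge> 1"
    and "1 \<le> r" and "r \<le> n div 2"
    and "\<sigma> permutes {1..n}" and "\<sigma> \<circ> \<sigma> = id"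
    and "length a = r" and "length b = r"
    and "set a \<subseteq> {1..n}" and "set b \<subseteq> {1..n}"
    and "distinct (a @ b)"
    and "\<sigma> = transposition_product a b"
  shows "real (num_fixed_points (weak_tuples n k) (sym_tensor_power n k \<sigma>)) =
    (\<Sum>l = 0..k div 2.
      ((real l + real r - 1) gchoose l) *
      ((real k - 2 * real l + real n - 2 * real r - 1) gchoose (k - 2 * l)))"
proof -
  define F where "F = {1..n} - (set a \<union> set b)"
  have fin_F: "finite F"
    by (simp add: F_def)
  have len: "length a = length b"
    using assms(7,8) by simp
  have image: "\<sigma> ` set a = set b"
    using map_transposition_product[OF len assms(11)] assms(12) by (metis set_map)
  have cards: "card (set a) = r" "card (set a \<union> set b) = 2 * r"
    using assms(7,8,11) distinct_card[of "a @ b"] by (simp_all add: distinct_card)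
  \<comment> \<open>Since \<open>2 * r\<close> \<le> \<open>n\<close>, the natural subtraction is
    exact and survives the cast. If \<open>F\<close> is empty, the upper argument of its binomial
    becomes \<open>k - 2 * l - 1\<close> over the reals, which is \<open>-1\<close> when
    \<open>k = 2 * l\<close>.\<close>
  have card_F: "real (card F) = real n - 2 * real r"
    using assms(4,9,10) cards(2) by (simp add: F_def card_Diff_subset)
  have union: "{1..n} = set a \<union> \<sigma> ` set a \<union> F"
    using assms(9,10) image by (auto simp: F_def)
  have "num_fixed_points (weak_tuples n k) (sym_tensor_power n k \<sigma>) =
      (\<Sum>l = 0..k div 2. card (multisets_of_size (set a) l) * card (multisets_of_size F (k - 2 * l)))"
    unfolding num_fixed_points_sym_tensor_power[OF assms(5)] union
  proof (rule card_invariant_multisets[OF assms(6)])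
    show "\<sigma> x = x" if "x \<in> F" for x
      using that transposition_product_outside[OF len] assms(12) by (simp add: F_def)
  qed (use assms(11) image in \<open>auto simp: F_def\<close>)
  also have "real \<dots> = (\<Sum>l = 0..k div 2. ((real l + real r - 1) gchoose l) *
      ((real k - 2 * real l + real n - 2 * real r - 1) gchoose (k - 2 * l)))"
  proof (simp only: of_nat_sum of_nat_mult, rule sum.cong[OF refl])
    fix l assume "l \<in> {0..k div 2}"
    then have arg: "real (k - 2 * l) + real (card F) - 1 = real k - 2 * real l + real n - 2 * real r - 1"
      by (simp add: of_nat_diff card_F)
    then show "real (card (multisets_of_size (set a) l)) * real (card (multisets_of_size F (k - 2 * l))) =
        ((real l + real r - 1) gchoose l) *
        ((real k - 2 * real l + real n - 2 * real r - 1) gchoose (k - 2 * l))"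
      by (simp only: card_multisets_of_size_gbinomial fin_F finite_set cards(1) arg)
  qed
  finally show ?thesis .
qed

end
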